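(* Let $E$ be an absolutely algebraic field of characteristic $p$ and $T=FG(E)$. Then $$RgMax(E)=\{F_p(T') : T' \text{ is a maximal } FG\text{-subset of } T\}.$$ In particular, there exists a one-one correspondence between $T_f$ and $RgMax(E)$; therefore $|RgMax(E)|=|T_f|$. Hence $E$ has only finitely many maximal subrings if and only if $T_f$ is finite; in other words, $E$ has only finitely many maximal subrings if and only if $E=F_p(T)$ where $T$ is an $FG$-set with only finitely many maximal $FG$-subsets.
   Context: All rings are commutative with $1\neq 0$ and subrings are unital. A proper subring $S$ of a ring $R$ is a maximal subring of $R$ if it is maximal with respect to inclusion among all proper subrings of $R$; $RgMax(R)$ denotes the set of all maximal subrings of $R$. An absolutely algebraic field of characteristic $p$ is a field algebraic over $\mathbb{F}_p$, $p$ prime; regard it as a subfield of a fixed algebraic closure $\bar{\mathbb{F}}_p$. Let $\mathbb{N}$ be the positive integers. A subset $T\subseteq\mathbb{N}$ is an $FG$-set (field generating set) if $\bigcup_{n\in T}\mathbb{F}_{p^n}$ is a subfield of $\bar{\mathbb{F}}_p$ ($p$ prime) and whenever $T\subseteq T'\subseteq\mathbb{N}$ with $\bigcup_{n\in T'}\mathbb{F}_{p^n}=\bigcup_{n\in T}\mathbb{F}_{p^n}$ then $T=T'$; equivalently, $1\in T$, $T$ is closed under divisors, and $T$ is closed under least common multiples. For an $FG$-set $T$ put $F_p(T)=\bigcup_{n\in T}\mathbb{F}_{p^n}$; for a subfield $E\subseteq\bar{\mathbb{F}}_p$, $FG(E)=\{n\in\mathbb{N}:\mathbb{F}_{p^n}\subseteq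 E\}$ is the $FG$-set with $F_p(FG(E))=E$. For $FG$-sets $T_1\subsetneq T_2$, $T_1$ is a maximal $FG$-subset of $T_2$ if there is no $FG$-set properly between them. For an $FG$-set $T$, $T_f$ is the set of primes $q$ for which there is $n\in\mathbb{N}$ with $q^n\in T$ and $q^{n+1}\notin T$. *)

theory Defs
  imports "HOL-Algebra.Algebraic_Closure" "HOL-Computational_Algebra.Primes"
begin

unbundle cardinal_syntax

text \<open>
  Throughout, \<open>L\<close> is meant to be an algebraic closure of a field with \<open>p\<close> elements, \<open>p\<close> prime.
  An absolutely algebraic field of characteristic \<open>p\<close> is regarded as a subfield \<open>E\<close> of \<open>L\<close>;
  as a ring it is \<open>L\<lparr>carrier := E\<rparr>\<close>.
\<close>

definition maximal_subring :: "'a set \<Rightarrow> ('a, 'b) ring_scheme \<Rightarrow> bool" where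
  "maximal_subring S R \<longleftrightarrow>
     subring S R \<and> S \<noteq> carrier R \<and>
     (\<forall>S'. subring S' R \<and> S' \<noteq> carrier R \<and> S \<subseteq> S' \<longrightarrow> S' = S)"

definition RgMax :: "('a, 'b) ring_scheme \<Rightarrow> 'a set set" where
  "RgMax R = {S. maximal_subring S R}"

text \<open>
  The field with \<open>p ^ n\<close> elements inside \<open>L\<close>. For \<open>n \<ge> 1\<close> it exists and is unique
  when \<open>L\<close> is an algebraic closure of a field with \<open>p\<close> elements.
\<close>

definition GF_in :: "('a, 'b) ring_scheme \<Rightarrow> nat \<Rightarrow> nat \<Rightarrow> 'a set" where
  "GF_in L p n = (THE K. subfield K L \<and> card K = p ^ n)"

text \<open>\<open>F\<^sub>p(T)\<close>\<close>

definition field_of :: "('a, 'b) ring_scheme \<Rightarrow> nat \<Rightarrow> nat set \<Rightarrow> 'a set" where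
  "field_of L p T = (\<Union>n\<in>T. GF_in L p n)"

definition FG_set :: "('a, 'b) ring_scheme \<Rightarrow> nat \<Rightarrow> nat set \<Rightarrow> bool" where
  "FG_set L p T \<longleftrightarrow>
     T \<subseteq> {1..} \<and> subfield (field_of L p T) L \<and>
     (\<forall>T'. T \<subseteq> T' \<and> T' \<subseteq> {1..} \<and> field_of L p T' = field_of L p T \<longrightarrow> T = T')"

definition FG :: "('a, 'b) ring_scheme \<Rightarrow> nat \<Rightarrow> 'a set \<Rightarrow> nat set" where
  "FG L p E = {n. 1 \<le> n \<and> GF_in L p n \<subseteq> E}"

definition maximal_FG_subset ::
    "('a, 'b) ring_scheme \<Rightarrow> nat \<Rightarrow> nat set \<Rightarrow> nat set \<Rightarrow> bool" where
  "maximal_FG_subset L p T1 T2 \<longleftrightarrow>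
     FG_set L p T1 \<and> FG_set L p T2 \<and> T1 \<subset> T2 \<and>
     \<not> (\<exists>T. FG_set L p T \<and> T1 \<subset> T \<and> T \<subset> T2)"

text \<open>The set \<open>T\<^sub>f\<close>\<close>

definition f_primes :: "nat set \<Rightarrow> nat set" where
  "f_primes T = {q. Factorial_Ring.prime q \<and> (\<exists>n\<ge>1. q ^ n \<in> T \<and> q ^ (n + 1) \<notin> T)}"

end

theory Submission
  imports Defs
begin

text \<open>
  Write \<open>F(n)\<close> for the subfield of \<open>L\<close> with \<open>p ^ n\<close> elements. Everything rests on the fact that
  the lattice of subrings of \<open>L\<close> is a lattice of sets of numbers.

  A polynomial \<open>X ^ (p ^ n) - X\<close> splits over \<open>L\<close> with simple roots, so the fixed points of the
  \<open>n\<close>-th power of Frobenius form the one and only subfield \<open>F(n)\<close>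
  (\<open>card_frobenius_fixed\<close>, \<open>GF_in_eq_fixed\<close>), and comparing exponents gives
  \<open>F(m) \<subseteq> F(n) \<longleftrightarrow> m dvd n\<close> (\<open>fixed_subset_iff_dvd\<close>). If \<open>x\<close> lies in a subring \<open>S\<close>, then \<open>S\<close>
  contains the prime field and hence the finite field generated by \<open>x\<close>, which is some \<open>F(k)\<close>
  (\<open>element_in_fixed\<close>). So each subring is a field and a union of fields \<open>F(k)\<close>, and it is
  determined by the set of those \<open>n\<close> with \<open>F(n) \<subseteq> S\<close>. The sets that arise are the FG-sets, and they
  are the sets closed under divisors and least common multiples (\<open>FG_set_iff_divisor_ideal\<close>).
  The two inclusion-preserving maps \<open>FG\<close> and \<open>field_of\<close> are mutually inverse
  (\<open>field_of_FG\<close>, \<open>FG_field_of\<close>), so they match maximal subrings of \<open>E\<close> with maximal FG-subsets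
  of \<open>FG(E)\<close> (\<open>RgMax_eq_image\<close>).

  What remains is arithmetic. An FG-set \<open>T\<close> consists of the divisors of a Steinitz number \<open>N\<close>, a
  formal product of prime powers with exponents up to infinity. Lowering one finite exponent by one
  gives the divisors of \<open>N / q\<close>, a maximal smaller FG-set; an infinite exponent cannot be lowered
  minimally. Hence the maximal FG-subsets are the sets \<open>{n. q * n \<in> T}\<close> for the primes \<open>q\<close> with
  finite nonzero exponent in \<open>N\<close>, which are the elements of \<open>T\<^sub>f\<close>
  (\<open>bij_betw_f_primes_maximal_subideals\<close>). The last equivalence follows because \<open>FG(E)\<close> is the only
  FG-set that represents \<open>E\<close>.
\<close>

section \<open>Sets of divisors of a Steinitz number\<close>

text \<open>
  These are the ideals of the lattice of positive integers ordered by divisibility. Each one is the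
  set of divisors of a Steinitz number. \<open>FG_set_iff_divisor_ideal\<close> identifies them with the FG-sets.
\<close>

definition divisor_ideal :: "nat set \<Rightarrow> bool" where
  "divisor_ideal T \<longleftrightarrow>
     0 \<notin> T \<and> 1 \<in> T \<and> (\<forall>n\<in>T. \<forall>d. d dvd n \<longrightarrow> d \<in> T) \<and> (\<forall>m\<in>T. \<forall>n\<in>T. lcm m n \<in> T)"

definition maximal_subideal :: "nat set \<Rightarrow> nat set \<Rightarrow> bool" where
  "maximal_subideal T' T \<longleftrightarrow>
     divisor_ideal T' \<and> T' \<subset> T \<and> (\<forall>S. divisor_ideal S \<and> T' \<subseteq> S \<and> S \<subset> T \<longrightarrow> S = T')"

lemma divisor_idealD:
  assumes "divisor_ideal T"
  shows "0 \<notin> T" "1 \<in> T" "n \<in> T \<Longrightarrow> d dvd n \<Longrightarrow> d \<in> T" "m \<in> T \<Longrightarrow> n \<in> T \<Longrightarrow> lcm m n \<in> T"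
  using assms unfolding divisor_ideal_def by blast+

lemma divisor_ideal_coprime_mult:
  assumes "divisor_ideal T" "m \<in> T" "n \<in> T" "coprime m n"
  shows "m * n \<in> T"
  using divisor_idealD(4)[OF assms(1-3)] assms(4) by (simp add: lcm_coprime)

text \<open>
  If \<open>T\<close> is the set of divisors of the Steinitz number \<open>N\<close>, this is the set of divisors of \<open>N / q\<close>.
  Describing it by \<open>q * n \<in> T\<close> avoids any mention of the exponent of \<open>q\<close> in \<open>N\<close>.
\<close>

lemma divisor_ideal_quotient:
  assumes T: "divisor_ideal T" and q: "q \<in> T"
  shows "divisor_ideal {n. q * n \<in> T}"
proof -
  have "q * lcm m n \<in> T" if "q * m \<in> T" "q * n \<in> T" for m n
    using divisor_idealD(4)[OF T that] by (simp add: lcm_mult_left)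
  moreover have "q * d \<in> T" if "q * n \<in> T" "d dvd n" for n d
    using divisor_idealD(3)[OF T that(1)] that(2) by (simp add: mult_dvd_mono)
  ultimately show ?thesis
    using divisor_idealD(1)[OF T] q unfolding divisor_ideal_def by auto
qed

text \<open>
  Capping the exponent of \<open>q\<close> at \<open>a - 1\<close> respects least common multiples because the exponent of
  \<open>q\<close> in \<open>lcm m n\<close> is the maximum of the two exponents. These sets serve below as intermediate
  ideals that test maximality.
\<close>

lemma divisor_ideal_bounded_prime_power:
  assumes T: "divisor_ideal T" and q: "Factorial_Ring.prime q" and a: "1 \<le> a"
  shows "divisor_ideal {n \<in> T. \<not> q ^ a dvd n}"
proof -
  have "\<not> q ^ a dvd lcm m n" if "m \<in> T" "n \<in> T" "\<not> q ^ a dvd m" "\<not> q ^ a dvd n" for m n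
  proof -
    have "m \<noteq> 0" "n \<noteq> 0" "lcm m n \<noteq> 0"
      using divisor_idealD(1)[OF T] that by (metis, metis, metis lcm_eq_0_iff)
    then show ?thesis
      using that(3,4) prime_gt_1_nat[OF q]
      by (simp add: power_dvd_iff_le_multiplicity multiplicity_lcm[OF _ _ q] max_def)
  qed
  moreover have "\<not> q ^ a dvd 1"
    using q a prime_gt_1_nat[OF q] by simp
  ultimately show ?thesis
    using T unfolding divisor_ideal_def by (blast intro: dvd_trans)
qed

lemma f_primesE:
  assumes "divisor_ideal T" "q \<in> f_primes T"
  obtains e where "Factorial_Ring.prime q" "1 \<le> e" "q ^ e \<in> T" "q ^ Suc e \<notin> T" "q \<in> T"
proof -
  obtain e where e: "Factorial_Ring.prime q" "1 \<le> e" "q ^ e \<in> T" "q ^ Suc e \<notin> T"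
    using assms(2) unfolding f_primes_def by auto
  then have "q \<in> T"
    using divisor_idealD(3)[OF assms(1) e(3), of q] by (simp add: dvd_power)
  with e show ?thesis by (rule that)
qed

text \<open>
  The exponent of \<open>q\<close> in \<open>n\<close> is smaller than \<open>e\<close>, so there is room for one more factor \<open>q\<close>: \<open>q * n\<close>
  is the product of a power of \<open>q\<close> that divides \<open>q ^ e\<close> and the part of \<open>n\<close> prime to \<open>q\<close>.
\<close>

lemma mult_in_divisor_ideal:
  assumes T: "divisor_ideal T" and q: "Factorial_Ring.prime q" and "q ^ e \<in> T" "n \<in> T"
    and "\<not> q ^ e dvd n"
  shows "q * n \<in> T"
proof -
  define a where "a = multiplicity q n"
  have "n \<noteq> 0" using assms divisor_idealD(1) by metis
  then obtain m where m: "n = q ^ a * m" "\<not> q dvd m"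
    unfolding a_def using multiplicity_decompose'[of n q] q
    by (metis not_prime_unit)
  have "a < e"
    using \<open>\<not> q ^ e dvd n\<close> m(1) by (metis dvd_triv_left le_imp_power_dvd linorder_not_less dvd_trans)
  then have "q ^ Suc a \<in> T"
    using divisor_idealD(3)[OF T \<open>q ^ e \<in> T\<close>] by (simp add: le_imp_power_dvd del: power_Suc)
  moreover have "m \<in> T"
    using divisor_idealD(3)[OF T \<open>n \<in> T\<close>] m(1) by simp
  moreover have "coprime (q ^ Suc a) m"
    using q m(2) by (metis coprime_power_left_iff prime_imp_coprime)
  ultimately have "q ^ Suc a * m \<in> T"
    using divisor_ideal_coprime_mult[OF T] by blast
  then show ?thesis using m(1) by (simp add: mult.assoc)
qed

text \<open>
  Let \<open>e\<close> be the exponent of \<open>q\<close> in \<open>T\<close>. An ideal that is larger than the quotient by \<open>q\<close> contains some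
  \<open>s\<close> with full exponent \<open>e\<close>, hence \<open>q ^ e\<close> itself. The quotient contains all elements of \<open>T\<close> prime
  to \<open>q\<close>, and these together with \<open>q ^ e\<close> generate \<open>T\<close>.
\<close>

lemma maximal_subideal_quotient:
  assumes T: "divisor_ideal T" and qf: "q \<in> f_primes T"
  shows "maximal_subideal {n. q * n \<in> T} T"
proof -
  obtain e where e: "Factorial_Ring.prime q" "1 \<le> e" "q ^ e \<in> T" "q ^ Suc e \<notin> T" "q \<in> T"
    using f_primesE[OF assms] .
  let ?Q = "{n. q * n \<in> T}"
  have Q: "divisor_ideal ?Q" by (rule divisor_ideal_quotient[OF T e(5)])
  have "?Q \<subseteq> T" using dvd_triv_right divisor_idealD(3)[OF T] by blast
  moreover have "q ^ e \<notin> ?Q" using e(4) by simp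
  ultimately have proper: "?Q \<subset> T" using e(3) by blast
  have "S = ?Q" if S: "divisor_ideal S" "?Q \<subseteq> S" "S \<subset> T" for S
  proof (rule ccontr)
    assume "S \<noteq> ?Q"
    then obtain s where s: "s \<in> S" "q * s \<notin> T" using S(2) by blast
    have "q ^ e dvd s"
      using mult_in_divisor_ideal[OF T e(1,3)] s S(3) by blast
    then have qe: "q ^ e \<in> S" using divisor_idealD(3)[OF S(1) s(1)] by blast
    have "n \<in> S" if n: "n \<in> T" for n
    proof -
      have "n \<noteq> 0" using n divisor_idealD(1)[OF T] by metis
      then obtain a m where m: "n = q ^ a * m" "\<not> q dvd m"
        using multiplicity_decompose'[of n q] e(1) by (metis not_prime_unit)
      have "q ^ a \<in> T" and mT: "m \<in> T"
        using divisor_idealD(3)[OF T n] m(1) by simp_all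
      have "a \<le> e"
        using divisor_idealD(3)[OF T \<open>q ^ a \<in> T\<close>] e(4) by (meson le_imp_power_dvd not_less_eq_eq)
      then have "q ^ a \<in> S" using divisor_idealD(3)[OF S(1) qe] by (simp add: le_imp_power_dvd)
      moreover have "coprime q m" using e(1) m(2) by (simp add: prime_imp_coprime)
      moreover have "m \<in> S"
        using divisor_ideal_coprime_mult[OF T e(5) mT \<open>coprime q m\<close>] S(2) by blast
      ultimately show ?thesis
        using divisor_ideal_coprime_mult[OF S(1)] m(1) by simp
    qed
    then show False using S(3) by blast
  qed
  then show ?thesis using Q proper unfolding maximal_subideal_def by blast
qed

text \<open>
  The full power \<open>q ^ e\<close> is lost in the quotient by \<open>q\<close> but survives in the quotient by any other
  prime.
\<close>

lemma inj_on_quotient_f_primes: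
  assumes T: "divisor_ideal T"
  shows "inj_on (\<lambda>q. {n. q * n \<in> T}) (f_primes T)"
proof (rule inj_onI, rule ccontr)
  fix q r assume qr: "q \<in> f_primes T" "r \<in> f_primes T" "{n. q * n \<in> T} = {n. r * n \<in> T}" "q \<noteq> r"
  obtain e where e: "Factorial_Ring.prime q" "q ^ e \<in> T" "q ^ Suc e \<notin> T"
    using f_primesE[OF T qr(1)] by metis
  have r: "Factorial_Ring.prime r" "r \<in> T" using f_primesE[OF T qr(2)] by metis+
  have "coprime r (q ^ e)" using e(1) r(1) qr(4) by (simp add: primes_coprime)
  then have "r * q ^ e \<in> T" using divisor_ideal_coprime_mult[OF T r(2) e(2)] by blast
  then have "q ^ e \<in> {n. q * n \<in> T}" using qr(3) by blast
  then show False using e(3) by simp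
qed

text \<open>
  A positive integer is the product of its pairwise coprime prime powers, so an ideal that contains
  all of these contains the integer.
\<close>

lemma missing_prime_power:
  assumes T': "divisor_ideal T'" and n: "n \<notin> T'" "n \<noteq> 0"
  obtains q a where "Factorial_Ring.prime q" "1 \<le> a" "q ^ a dvd n" "q ^ a \<notin> T'"
proof -
  have "\<exists>q k. Factorial_Ring.prime q \<and> q ^ k dvd n \<and> q ^ k \<notin> T'" using n
  proof (induction n rule: less_induct)
    case (less n)
    have "n \<noteq> 1" using less.prems divisor_idealD(2)[OF T'] by blast
    then obtain q where q: "Factorial_Ring.prime q" "q dvd n" using prime_factor_nat by blast
    obtain m where m: "n = q ^ multiplicity q n * m" "\<not> q dvd m"
      using multiplicity_decompose'[of n q] q less.prems by (metis not_prime_unit)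
    have "multiplicity q n \<noteq> 0" using m q(2) by (metis mult_1 power_0)
    then have "1 < q ^ multiplicity q n"
      using prime_gt_1_nat[OF q(1)] one_less_power by blast
    moreover have "m \<noteq> 0" using m(2) by (metis dvd_0_right)
    moreover have "m dvd n" using dvd_triv_right[of m] m(1) by metis
    ultimately have "m < n" "m \<noteq> 0" "m dvd n"
      using m(1) mult_less_mono1[of 1 "q ^ multiplicity q n" m] by simp_all
    show ?case
    proof (cases "q ^ multiplicity q n \<in> T'")
      case True
      have "coprime (q ^ multiplicity q n) m" using q(1) m(2) by (simp add: prime_imp_coprime)
      then have "m \<notin> T'" using divisor_ideal_coprime_mult[OF T' True] m(1) less.prems by metis
      then show ?thesis using less.IH[OF \<open>m < n\<close> _ \<open>m \<noteq> 0\<close>] \<open>m dvd n\<close> dvd_trans by blast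
    next
      case False
      then show ?thesis using q(1) multiplicity_dvd by blast
    qed
  qed
  then obtain q a where q: "Factorial_Ring.prime q" "q ^ a dvd n" "q ^ a \<notin> T'" by blast
  moreover have "a \<noteq> 0" using q(3) divisor_idealD(2)[OF T'] by (metis power_0)
  ultimately show ?thesis using that[of q a] by simp
qed

text \<open>
  Choose a prime power \<open>q ^ a\<close> in \<open>T\<close> that \<open>T'\<close> misses. Then all elements of \<open>T'\<close> have exponent of \<open>q\<close>
  below \<open>a\<close>. If \<open>q ^ Suc a\<close> were in \<open>T\<close>, capping the exponent at \<open>a\<close> would give an ideal strictly
  between \<open>T'\<close> and \<open>T\<close>. So the exponent of \<open>q\<close> in \<open>T\<close> is exactly \<open>a\<close>, and \<open>T'\<close> lies in the
  quotient by \<open>q\<close>.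
\<close>

lemma maximal_subideal_is_quotient:
  assumes T: "divisor_ideal T" and max: "maximal_subideal T' T"
  shows "\<exists>q\<in>f_primes T. T' = {n. q * n \<in> T}"
proof -
  have T': "divisor_ideal T'" "T' \<subset> T"
    and maxD: "\<And>S. divisor_ideal S \<Longrightarrow> T' \<subseteq> S \<Longrightarrow> S \<subset> T \<Longrightarrow> S = T'"
    using max unfolding maximal_subideal_def by blast+
  obtain n where n: "n \<in> T" "n \<notin> T'" using T'(2) by blast
  have "n \<noteq> 0" using n divisor_idealD(1)[OF T] by metis
  then obtain q a where q: "Factorial_Ring.prime q" and a: "1 \<le> a" "q ^ a dvd n" "q ^ a \<notin> T'"
    using missing_prime_power[OF T'(1) n(2)] by metis
  have qa: "q ^ a \<in> T" using divisor_idealD(3)[OF T n(1) a(2)] .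
  let ?B = "\<lambda>b. {n \<in> T. \<not> q ^ b dvd n}"
  have sub: "T' \<subseteq> ?B a" using T'(2) divisor_idealD(3)[OF T'(1)] a(3) by blast
  have "q ^ Suc a \<notin> T"
  proof
    assume *: "q ^ Suc a \<in> T"
    have "q ^ a dvd n" if "q ^ Suc a dvd n" for n
      using dvd_trans[OF le_imp_power_dvd[of a "Suc a" q] that] by simp
    then have "T' \<subseteq> ?B (Suc a)" using sub by blast
    moreover have "q ^ Suc a \<notin> ?B (Suc a)" by simp
    then have "?B (Suc a) \<subset> T" using * by blast
    ultimately have "?B (Suc a) = T'"
      using maxD divisor_ideal_bounded_prime_power[OF T q, of "Suc a"] by simp
    moreover have "q ^ a \<in> ?B (Suc a)"
      using qa prime_gt_1_nat[OF q] power_dvd_imp_le[of q "Suc a" a] by auto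
    ultimately show False using a(3) by blast
  qed
  then have qf: "q \<in> f_primes T" using q a(1) qa unfolding f_primes_def by auto
  have "T' \<subseteq> {n. q * n \<in> T}"
    using sub mult_in_divisor_ideal[OF T q qa] by blast
  moreover have "divisor_ideal {n. q * n \<in> T}" "{n. q * n \<in> T} \<subset> T"
    using maximal_subideal_quotient[OF T qf] unfolding maximal_subideal_def by blast+
  ultimately show ?thesis using maxD qf by blast
qed

theorem bij_betw_f_primes_maximal_subideals:
  assumes "divisor_ideal T"
  shows "bij_betw (\<lambda>q. {n. q * n \<in> T}) (f_primes T) {T'. maximal_subideal T' T}"
  unfolding bij_betw_def
  using inj_on_quotient_f_primes[OF assms] maximal_subideal_quotient[OF assms]
    maximal_subideal_is_quotient[OF assms] by blast

section \<open>Frobenius and the separability of X ^ q - X\<close>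

lemma (in cring) binomial:
  assumes x: "x \<in> carrier R" and y: "y \<in> carrier R"
  shows "(x \<oplus> y) [^] (n::nat) = (\<Oplus>i\<in>{..n}. [(n choose i)] \<cdot> (x [^] i \<otimes> y [^] (n - i)))"
proof (induction n)
  case 0
  show ?case using x y by simp
next
  case (Suc n)
  let ?t = "\<lambda>i. [(n choose i)] \<cdot> (x [^] i \<otimes> y [^] (n - i))"
  let ?u = "\<lambda>i. [(n choose i)] \<cdot> (x [^] i \<otimes> y [^] (Suc n - i))"
  let ?f = "\<lambda>i. [(Suc n choose i)] \<cdot> (x [^] i \<otimes> y [^] (Suc n - i))"
  note xy = x y
  have tc: "?t \<in> A \<rightarrow> carrier R" and uc: "?u \<in> A \<rightarrow> carrier R" and fc: "?f \<in> A \<rightarrow> carrier R" for A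
    using xy by auto
  \<comment> \<open>Pascal's rule, with one of the two summands already in the shape produced by the induction hypothesis.\<close>
  have pascal: "?f (Suc i) = ?t i \<otimes> x \<oplus> ?u (Suc i)" if "i \<le> n" for i
  proof -
    have "?t i \<otimes> x = [(n choose i)] \<cdot> (x [^] Suc i \<otimes> y [^] (n - i))"
      using xy by (simp add: add_pow_ldistr add_pow_rdistr m_ac)
    then show ?thesis
      using xy by (simp add: add.nat_pow_mult)
  qed
  have "(\<Oplus>i\<in>{..Suc n}. ?f i) = (\<Oplus>i\<in>{..n}. ?f (Suc i)) \<oplus> ?f 0"
    by (rule finsum_Suc2[OF fc])
  also have "(\<Oplus>i\<in>{..n}. ?f (Suc i)) = (\<Oplus>i\<in>{..n}. ?t i \<otimes> x \<oplus> ?u (Suc i))"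
    using pascal xy by (intro finsum_cong') auto
  also have "\<dots> = (\<Oplus>i\<in>{..n}. ?t i \<otimes> x) \<oplus> (\<Oplus>i\<in>{..n}. ?u (Suc i))"
    using xy by (intro finsum_addf) auto
  also have "\<dots> \<oplus> ?f 0 = (\<Oplus>i\<in>{..n}. ?t i \<otimes> x) \<oplus> ((\<Oplus>i\<in>{..n}. ?u (Suc i)) \<oplus> ?u 0)"
    using xy by (subst a_assoc) (auto intro!: finsum_closed)
  also have "(\<Oplus>i\<in>{..n}. ?u (Suc i)) \<oplus> ?u 0 = (\<Oplus>i\<in>{..Suc n}. ?u i)"
    by (rule finsum_Suc2[OF uc, symmetric])
  also have "\<dots> = (\<Oplus>i\<in>{..n}. ?u i)"
    using xy uc by (subst finsum_Suc) (auto intro!: finsum_closed simp: binomial_eq_0)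
  also have "\<dots> = (\<Oplus>i\<in>{..n}. ?t i \<otimes> y)"
    using xy by (intro finsum_cong') (auto simp: add_pow_ldistr m_assoc Suc_diff_le)
  also have "(\<Oplus>i\<in>{..n}. ?t i \<otimes> x) = (\<Oplus>i\<in>{..n}. ?t i) \<otimes> x"
    using tc x by (intro finsum_ldistr[symmetric]) auto
  also have "(\<Oplus>i\<in>{..n}. ?t i \<otimes> y) = (\<Oplus>i\<in>{..n}. ?t i) \<otimes> y"
    using tc y by (intro finsum_ldistr[symmetric]) auto
  also have "(\<Oplus>i\<in>{..n}. ?t i) \<otimes> x \<oplus> (\<Oplus>i\<in>{..n}. ?t i) \<otimes> y = (\<Oplus>i\<in>{..n}. ?t i) \<otimes> (x \<oplus> y)"
    using tc xy by (simp add: r_distr finsum_closed)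
  also have "\<dots> = (x \<oplus> y) [^] Suc n"
    using Suc.IH by simp
  finally show ?case by simp
qed

lemma (in cring) char_annihilates:
  assumes "[(p::nat)] \<cdot> \<one> = \<zero>" and "p dvd k" and "x \<in> carrier R"
  shows "[k] \<cdot> x = \<zero>"
proof -
  obtain m where k: "k = p * m" using assms(2) by blast
  have "[p] \<cdot> x = ([p] \<cdot> \<one>) \<otimes> x" using assms(3) by (simp add: add_pow_ldistr)
  then have "[p] \<cdot> x = \<zero>" using assms by simp
  then show ?thesis
    unfolding k using assms(3) by (simp flip: add.nat_pow_pow)
qed

text \<open>
  All inner binomial coefficients are divisible by \<open>p\<close>. Writing \<open>p\<close> as \<open>m + 2\<close> in the proof lets both
  ends of the binomial sum be split off.
\<close>

lemma (in cring) freshmans_dream: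
  assumes p: "Factorial_Ring.prime p" and char: "[(p::nat)] \<cdot> \<one> = \<zero>"
    and x: "x \<in> carrier R" and y: "y \<in> carrier R"
  shows "(x \<oplus> y) [^] p = x [^] p \<oplus> y [^] p"
proof -
  obtain m where m: "p = Suc (Suc m)"
    using le_Suc_ex[OF prime_ge_2_nat[OF p]] by auto
  let ?t = "\<lambda>i. [(p choose i)] \<cdot> (x [^] i \<otimes> y [^] (p - i))"
  have tc: "?t \<in> A \<rightarrow> carrier R" for A using x y by auto
  have "?t (Suc i) = \<zero>" if "i \<in> {..m}" for i
    using that x y m by (intro char_annihilates[OF char] dvd_choose_prime[OF _ _ _ p]) auto
  then have "(\<Oplus>i\<in>{..m}. ?t (Suc i)) = (\<Oplus>i\<in>{..m}. \<zero>)"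
    by (intro finsum_cong') auto
  then have middle: "(\<Oplus>i\<in>{..m}. ?t (Suc i)) = \<zero>" by simp
  have "(x \<oplus> y) [^] p = (\<Oplus>i\<in>{..Suc (Suc m)}. ?t i)"
    using binomial[OF x y, of p] m by simp
  also have "\<dots> = ?t (Suc (Suc m)) \<oplus> ((\<Oplus>i\<in>{..m}. ?t (Suc i)) \<oplus> ?t 0)"
    by (simp only: finsum_Suc[OF tc, of "Suc m"] finsum_Suc2[OF tc, of m])
  also have "\<dots> = x [^] p \<oplus> y [^] p"
    unfolding middle using x y m by (simp del: nat_pow_Suc)
  finally show ?thesis .
qed

lemma (in cring) frobenius_power_add:
  assumes "Factorial_Ring.prime p" "[(p::nat)] \<cdot> \<one> = \<zero>" "x \<in> carrier R" "y \<in> carrier R"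
  shows "(x \<oplus> y) [^] (p ^ n) = x [^] (p ^ n) \<oplus> y [^] (p ^ n)"
proof (induction n)
  case 0
  then show ?case using assms by (simp del: One_nat_def add: nat_pow_eone)
next
  case (Suc n)
  have pow: "z [^] (p ^ Suc n) = (z [^] (p ^ n)) [^] p" if "z \<in> carrier R" for z
    using that by (simp add: nat_pow_pow mult.commute)
  show ?case
    using assms Suc.IH by (simp add: pow freshmans_dream[OF assms(1,2)] del: power_Suc)
qed

lemma (in cring) frobenius_power_diff:
  assumes "Factorial_Ring.prime p" "[(p::nat)] \<cdot> \<one> = \<zero>" "x \<in> carrier R" "y \<in> carrier R"
  shows "(x \<ominus> y) [^] (p ^ n) = x [^] (p ^ n) \<ominus> y [^] (p ^ n)"
proof -
  have "x \<ominus> y \<oplus> y = x" using assms(3,4) by algebra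
  then have "x [^] (p ^ n) = (x \<ominus> y) [^] (p ^ n) \<oplus> y [^] (p ^ n)"
    using frobenius_power_add[OF assms(1,2), of "x \<ominus> y" y n] assms(3,4) by simp
  moreover have "(x \<ominus> y) [^] (p ^ n) \<in> carrier R" "y [^] (p ^ n) \<in> carrier R"
    using assms(3,4) by simp_all
  ultimately show ?thesis by algebra
qed

text \<open>
  This makes the Frobenius identities available for polynomials, where the separability argument
  uses them.
\<close>

lemma (in domain) poly_ring_char:
  assumes "[(p::nat)] \<cdot> \<one> = \<zero>"
  shows "[p] \<cdot>\<^bsub>poly_ring R\<^esub> \<one>\<^bsub>poly_ring R\<^esub> = \<zero>\<^bsub>poly_ring R\<^esub>"
proof -
  interpret UP: domain "poly_ring R"
    using univ_poly_is_domain[OF carrier_is_subring] .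
  have hom: "poly_of_const \<in> ring_hom R (poly_ring R)"
    using canonical_embedding_is_hom[OF carrier_is_subring] by simp
  have zero: "poly_of_const \<zero> = \<zero>\<^bsub>poly_ring R\<^esub>"
    by (simp add: poly_of_const_def univ_poly_zero)
  have "poly_of_const ([n] \<cdot> \<one>) = [n] \<cdot>\<^bsub>poly_ring R\<^esub> \<one>\<^bsub>poly_ring R\<^esub>" for n :: nat
    by (induction n) (simp_all add: zero ring_hom_add[OF hom] ring_hom_one[OF hom])
  from this[of p] show ?thesis using assms zero by simp
qed

definition (in ring) frobenius_poly :: "nat \<Rightarrow> 'a list" where
  "frobenius_poly q = X [^]\<^bsub>poly_ring R\<^esub> q \<ominus>\<^bsub>poly_ring R\<^esub> X"

lemma (in domain) frobenius_poly_carrier: "frobenius_poly q \<in> carrier (poly_ring R)"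
proof -
  interpret UP: domain "poly_ring R"
    using univ_poly_is_domain[OF carrier_is_subring] .
  show ?thesis unfolding frobenius_poly_def
    using var_closed(1)[OF carrier_is_subring] by simp
qed

lemma (in domain) degree_frobenius_poly:
  assumes "1 < q"
  shows "degree (frobenius_poly q) = q"
proof -
  interpret UP: domain "poly_ring R"
    using univ_poly_is_domain[OF carrier_is_subring] .
  have X: "X \<in> carrier (poly_ring R)" using var_closed(1)[OF carrier_is_subring] .
  have dX: "degree X = 1" by (simp add: var_def)
  have 1: "degree (X [^]\<^bsub>poly_ring R\<^esub> q) = q"
    using polynomial_pow_degree[OF X] dX by simp
  have 2: "degree (\<ominus>\<^bsub>poly_ring R\<^esub> X) = 1"
    using univ_poly_a_inv_degree[OF carrier_is_subring X] dX by simp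
  show ?thesis
    unfolding frobenius_poly_def a_minus_def univ_poly_add
    using poly_add_degree_eq[OF carrier_is_subring, of "X [^]\<^bsub>poly_ring R\<^esub> q" "\<ominus>\<^bsub>poly_ring R\<^esub> X"]
      1 2 assms X by (simp add: univ_poly_carrier)
qed

lemma (in domain) eval_frobenius_poly:
  assumes "a \<in> carrier R"
  shows "eval (frobenius_poly q) a = a [^] q \<ominus> a"
proof -
  interpret UP: domain "poly_ring R"
    using univ_poly_is_domain[OF carrier_is_subring] .
  interpret ev: ring_hom_ring "poly_ring R" R "\<lambda>p. eval p a"
    using eval_ring_hom[OF carrier_is_subring assms] .
  have X: "X \<in> carrier (poly_ring R)" using var_closed(1)[OF carrier_is_subring] .
  show ?thesis
    unfolding frobenius_poly_def a_minus_def
    using X assms by (simp add: ev.hom_nat_pow eval_var del: eval.simps)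
qed

text \<open>
  Put \<open>Y = X - a\<close> and \<open>q = p ^ n\<close>. Since \<open>a ^ q = a\<close> and Frobenius is additive,
  \<open>X ^ q - X = Y ^ q - Y\<close>. A double root would make \<open>Y ^ 2\<close> divide this difference; it divides \<open>Y ^ q\<close>
  as well, hence it would divide \<open>Y\<close>.
\<close>

lemma (in domain) alg_mult_frobenius_poly_le_1:
  assumes p: "Factorial_Ring.prime p" and char: "[(p::nat)] \<cdot> \<one> = \<zero>" and n: "1 \<le> n"
    and a: "a \<in> carrier R" and root: "a [^] (p ^ n) = a"
  shows "alg_mult (frobenius_poly (p ^ n)) a \<le> 1"
proof (rule ccontr)
  interpret UP: domain "poly_ring R"
    using univ_poly_is_domain[OF carrier_is_subring] .
  let ?P = "poly_ring R" and ?q = "p ^ n" and ?C = "poly_of_const a" and ?Y = "[\<one>, \<ominus> a]"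
  have q: "2 \<le> ?q" using prime_ge_2_nat[OF p] self_le_power[of p n] n by linarith
  have hom: "poly_of_const \<in> ring_hom R ?P"
    using canonical_embedding_is_hom[OF carrier_is_subring] by simp
  have X: "X \<in> carrier ?P" using var_closed(1)[OF carrier_is_subring] .
  have C: "?C \<in> carrier ?P" using ring_hom_closed[OF hom a] .
  have Y: "?Y \<in> carrier ?P" using a unfolding sym[OF univ_poly_carrier] polynomial_def by auto
  have "?C [^]\<^bsub>?P\<^esub> k = poly_of_const (a [^] k)" for k :: nat
    by (induction k) (simp_all add: ring_hom_one[OF hom] ring_hom_mult[OF hom] a)
  then have Cq: "?C [^]\<^bsub>?P\<^esub> ?q = ?C" using root by simp
  have XYC: "X = ?Y \<oplus>\<^bsub>?P\<^esub> ?C"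
    using a by (auto simp: univ_poly_add var_def poly_of_const_def l_neg)
  have "X [^]\<^bsub>?P\<^esub> ?q = ?Y [^]\<^bsub>?P\<^esub> ?q \<oplus>\<^bsub>?P\<^esub> ?C"
    unfolding XYC using UP.frobenius_power_add[OF p poly_ring_char[OF char] Y C, of n] Cq by simp
  then have "frobenius_poly ?q = (?Y [^]\<^bsub>?P\<^esub> ?q \<oplus>\<^bsub>?P\<^esub> ?C) \<ominus>\<^bsub>?P\<^esub> (?Y \<oplus>\<^bsub>?P\<^esub> ?C)"
    unfolding frobenius_poly_def using XYC by simp
  also have "\<dots> = ?Y [^]\<^bsub>?P\<^esub> ?q \<ominus>\<^bsub>?P\<^esub> ?Y"
  proof -
    have "?Y [^]\<^bsub>?P\<^esub> ?q \<in> carrier ?P" using Y by blast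
    then show ?thesis using Y C by algebra
  qed
  finally have f: "frobenius_poly ?q = ?Y [^]\<^bsub>?P\<^esub> ?q \<ominus>\<^bsub>?P\<^esub> ?Y" .
  let ?Y2 = "?Y [^]\<^bsub>?P\<^esub> (2::nat)"
  assume "\<not> alg_mult (frobenius_poly ?q) a \<le> 1"
  then have d: "?Y2 pdivides frobenius_poly ?q"
    using le_alg_mult_imp_pdivides[OF a frobenius_poly_carrier, of 2] by simp
  have d': "?Y2 pdivides (?Y [^]\<^bsub>?P\<^esub> ?q)"
    by (rule polynomial_pow_division[OF Y q])
  obtain r s where r: "r \<in> carrier ?P" "frobenius_poly ?q = ?Y2 \<otimes>\<^bsub>?P\<^esub> r"
    and s: "s \<in> carrier ?P" "?Y [^]\<^bsub>?P\<^esub> ?q = ?Y2 \<otimes>\<^bsub>?P\<^esub> s"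
    using d d' unfolding pdivides_def factor_def by metis
  have "?Y [^]\<^bsub>?P\<^esub> ?q \<in> carrier ?P" using Y by blast
  then have "?Y = ?Y [^]\<^bsub>?P\<^esub> ?q \<ominus>\<^bsub>?P\<^esub> frobenius_poly ?q"
    unfolding f using Y by algebra
  also have "\<dots> = ?Y2 \<otimes>\<^bsub>?P\<^esub> (s \<ominus>\<^bsub>?P\<^esub> r)"
    unfolding r(2) s(2)
  proof -
    have "?Y2 \<in> carrier ?P" using Y by blast
    then show "?Y2 \<otimes>\<^bsub>?P\<^esub> s \<ominus>\<^bsub>?P\<^esub> ?Y2 \<otimes>\<^bsub>?P\<^esub> r = ?Y2 \<otimes>\<^bsub>?P\<^esub> (s \<ominus>\<^bsub>?P\<^esub> r)"
      using r s by algebra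
  qed
  finally have "?Y2 pdivides ?Y"
    unfolding pdivides_def factor_def using r s UP.minus_closed by metis
  then have "degree ?Y2 \<le> degree ?Y"
    using pdivides_imp_degree_le[OF carrier_is_subring _ Y] Y by simp
  then show False using polynomial_pow_degree[OF Y, of 2] by simp
qed

text \<open>
  The elements counted are the roots of \<open>X ^ (p ^ n) - X\<close>. This polynomial splits and its roots are
  simple, so there are as many of them as its degree. The bound \<open>1 \<le> n\<close> matters: for \<open>n = 0\<close> the
  equation is \<open>x = x\<close>.
\<close>

lemma (in algebraically_closed) card_frobenius_fixed:
  assumes p: "Factorial_Ring.prime p" and char: "[(p::nat)] \<cdot>\<^bsub>L\<^esub> \<one>\<^bsub>L\<^esub> = \<zero>\<^bsub>L\<^esub>" and n: "1 \<le> n"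
  shows "card {x \<in> carrier L. x [^]\<^bsub>L\<^esub> (p ^ n) = x} = p ^ n"
proof -
  let ?f = "frobenius_poly (p ^ n)" and ?F = "{x \<in> carrier L. x [^]\<^bsub>L\<^esub> (p ^ n) = x}"
  have f: "?f \<in> carrier (poly_ring L)" by (rule frobenius_poly_carrier)
  have q: "1 < p ^ n" using n prime_gt_1_nat[OF p] one_less_power[of p n] by linarith
  have deg: "degree ?f = p ^ n" using degree_frobenius_poly[OF q] .
  with q have "degree ?f \<noteq> 0" by linarith
  then have "?f \<noteq> []" by (metis diff_0_eq_0 list.size(3))
  have root: "is_root ?f x \<longleftrightarrow> x \<in> ?F" for x
  proof (cases "x \<in> carrier L")
    case True
    then show ?thesis
      using \<open>?f \<noteq> []\<close> r_right_minus_eq[of "x [^]\<^bsub>L\<^esub> (p ^ n)" x]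
      unfolding is_root_def eval_frobenius_poly[OF True] by simp
  qed (simp add: is_root_def)
  have set: "set_mset (roots ?f) = ?F"
    using roots_mem_iff_is_root[OF f] root by blast
  have "count (roots ?f) x = 1" if "x \<in> ?F" for x
  proof -
    have "alg_mult ?f x \<le> 1"
      using alg_mult_frobenius_poly_le_1[OF p char n] that by simp
    moreover have "alg_mult ?f x > 0"
      using alg_mult_gt_zero_iff_is_root[OF f] root that by blast
    ultimately show ?thesis using alg_mult_eq_count_roots[OF f] by (metis le_antisym less_eq_Suc_le One_nat_def)
  qed
  then have "size (roots ?f) = card ?F"
    unfolding size_multiset_overloaded_eq set by simp
  moreover have "size (roots ?f) = p ^ n"
    using roots_over_carrier[OF f] deg unfolding splitted_def by simp
  ultimately show ?thesis by simp
qed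

section \<open>Finite subfields and subrings\<close>

text \<open>
  Coordinates with respect to a basis identify \<open>E\<close> with the lists of length \<open>n\<close> over \<open>K\<close>.
\<close>

lemma (in ring) card_dimension:
  assumes K: "subfield K R" and "finite K" and dim: "dimension n K E"
  shows "card E = card K ^ n"
proof -
  obtain Vs where Vs: "set Vs \<subseteq> carrier R" "independent K Vs" "length Vs = n" "Span K Vs = E"
    using exists_base[OF K dim] by blast
  let ?C = "{Ks. set Ks \<subseteq> K \<and> length Ks = n}"
  have E: "E = (\<lambda>Ks. combine Ks Vs) ` ?C"
    using Span_eq_combine_set_length_version[OF K Vs(1)] Vs(3,4) by auto
  have "inj_on (\<lambda>Ks. combine Ks Vs) ?C"
    using unique_decomposition[OF K Vs(2)] Vs(3,4) E by (intro inj_onI) blast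
  then have "card E = card ?C" unfolding E by (rule card_image)
  also have "\<dots> = card K ^ n"
    by (rule card_lists_length_eq[OF \<open>finite K\<close>])
  finally show ?thesis .
qed

lemma (in field) pow_card_carrier:
  assumes "finite (carrier R)" "x \<in> carrier R"
  shows "x [^] card (carrier R) = x"
proof -
  obtain N where N: "card (carrier R) = Suc N"
    using assms card_gt_0_iff[of "carrier R"] gr0_conv_Suc by blast
  show ?thesis
  proof (cases "x = \<zero>")
    case True
    then show ?thesis using N by simp
  next
    case False
    let ?G = "Multiplicative_Group.mult_of R"
    have "x [^]\<^bsub>?G\<^esub> order ?G = \<one>\<^bsub>?G\<^esub>"
      using group.pow_order_eq_1[OF field_mult_group] assms(2) False by simp
    then have "x [^] N = \<one>"
      using order_mult_of[OF assms(1)] N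
      unfolding Multiplicative_Group.nat_pow_mult_of order_def by simp
    then show ?thesis using N assms(2) by simp
  qed
qed

lemma (in field) pow_card_subfield:
  assumes F: "subfield F R" and fin: "finite F" and x: "x \<in> F"
  shows "x [^] card F = x"
proof -
  have "x [^]\<^bsub>R\<lparr>carrier := F\<rparr>\<^esub> card F = x"
    using field.pow_card_carrier[OF subfield_iff(2)[OF F], of x] fin x by simp
  then show ?thesis using nat_pow_consistent[of x "card F" F] by simp
qed

lemma (in ring) subring_pow_closed:
  assumes "subring S R" "x \<in> S"
  shows "x [^] (n::nat) \<in> S"
  using assms subringE[OF assms(1)] by (induction n) auto

text \<open>
  The multiplicative group of a finite field is cyclic, and the powers of a generator lie in any
  subring that contains it. One element that generates \<open>F\<close> allows statements about elements, such as
  membership in a union of fields, to be turned into inclusions of fields.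
\<close>

lemma (in field) finite_subfield_generator:
  assumes F: "subfield F R" and fin: "finite F"
  obtains a where "a \<in> F" "\<And>S. subring S R \<Longrightarrow> a \<in> S \<Longrightarrow> F \<subseteq> S"
proof -
  interpret F: field "R\<lparr>carrier := F\<rparr>" by (rule subfield_iff(2)[OF F])
  obtain a where a: "a \<in> F" and gen: "F - {\<zero>} = {a [^]\<^bsub>R\<lparr>carrier := F\<rparr>\<^esub> i | i::nat. i \<in> UNIV}"
    using F.finite_field_mult_group_has_gen fin by (auto simp: nat_pow_mult_of)
  have "F \<subseteq> S" if S: "subring S R" "a \<in> S" for S
  proof
    fix x assume "x \<in> F"
    show "x \<in> S"
    proof (cases "x = \<zero>")
      case True
      then show ?thesis using subringE(2)[OF S(1)] by simp
    next
      case False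
      then obtain i :: nat where "x = a [^]\<^bsub>R\<lparr>carrier := F\<rparr>\<^esub> i" using gen \<open>x \<in> F\<close> by blast
      then have "x = a [^] i" using nat_pow_consistent[of a i F] by simp
      then show ?thesis using subring_pow_closed[OF S] by simp
    qed
  qed
  with a show ?thesis by (rule that)
qed

lemma (in ring) subring_of_subring_iff:
  assumes "subring E R"
  shows "subring S (R\<lparr>carrier := E\<rparr>) \<longleftrightarrow> subring S R \<and> S \<subseteq> E"
proof -
  interpret E: ring "R\<lparr>carrier := E\<rparr>" by (rule subring_is_ring[OF assms])
  have "subring S (R\<lparr>carrier := E\<rparr>) \<longleftrightarrow> subring S R" if "S \<subseteq> E"
    using E.subring_iff[of S] subring_iff[of S] that subringE(1)[OF assms] by simp
  then show ?thesis using subringE(1)[of S "R\<lparr>carrier := E\<rparr>"] by auto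
qed

section \<open>Subrings of an algebraic closure of a prime field\<close>

locale prime_field_closure = algebraic_closure L K for L (structure) and K +
  fixes p :: nat
  assumes prime_p: "Factorial_Ring.prime p" and card_K: "card K = p"
begin

text \<open>
  For \<open>n \<ge> 1\<close> this is the subfield with \<open>p ^ n\<close> elements. For \<open>n = 0\<close> it is all of \<open>L\<close>, in accordance with
  the rule that divisibility of exponents means inclusion, since each number divides \<open>0\<close>; so the
  Euclidean algorithm on exponents needs no exceptions.
\<close>

definition fixed :: "nat \<Rightarrow> 'a set" where
  "fixed n = {x \<in> carrier L. x [^] (p ^ n) = x}"

lemma finite_K: "finite K"
  using card_K prime_gt_0_nat[OF prime_p] card_gt_0_iff by metis

lemma char_p: "[p] \<cdot> \<one> = \<zero>"
proof -
  have sub: "subgroup K (add_monoid L)"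
    using subring.axioms(1)[OF subfieldE(1)[OF subfield_axioms]] .
  have "\<one> [^]\<^bsub>(add_monoid L)\<lparr>carrier := K\<rparr>\<^esub> order ((add_monoid L)\<lparr>carrier := K\<rparr>) = \<one>\<^bsub>(add_monoid L)\<lparr>carrier := K\<rparr>\<^esub>"
    using group.pow_order_eq_1[OF add.subgroup_imp_group[OF sub], of \<one>] subringE(3)[OF subfieldE(1)[OF subfield_axioms]] by simp
  then show ?thesis
    by (simp add: order_def card_K add_pow_def nat_pow_def)
qed

text \<open>
  By Lagrange's theorem the additive subgroup \<open>K \<inter> S\<close> of \<open>K\<close> has order \<open>1\<close> or \<open>p\<close>, and it contains both
  \<open>\<zero>\<close> and \<open>\<one>\<close>.
\<close>

lemma prime_field_subset:
  assumes S: "subring S L"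
  shows "K \<subseteq> S"
proof -
  have KS: "subring (K \<inter> S) L" and K: "subring K L"
    using subring_inter S subfieldE(1)[OF subfield_axioms] by blast+
  have sub: "subgroup K (add_monoid L)" "subgroup (K \<inter> S) (add_monoid L)"
    using subring.axioms(1) K KS by blast+
  interpret K: group "(add_monoid L)\<lparr>carrier := K\<rparr>"
    by (rule add.subgroup_imp_group[OF sub(1)])
  have "subgroup (K \<inter> S) ((add_monoid L)\<lparr>carrier := K\<rparr>)"
    using add.subgroup_incl[OF sub(2,1)] by blast
  then have dvd: "card (K \<inter> S) dvd p"
    using K.lagrange[of "K \<inter> S"] card_K by (metis dvd_triv_right order_def partial_object.select_convs(1) partial_object.update_convs(1))
  moreover have "card (K \<inter> S) \<noteq> 1"
  proof
    assume "card (K \<inter> S) = 1"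
    then obtain z where "K \<inter> S = {z}" by (auto simp: card_1_singleton_iff)
    then show False using subringE(2,3)[OF KS] one_not_zero by auto
  qed
  ultimately have "card (K \<inter> S) = p" using prime_p dvd unfolding prime_nat_iff by blast
  then have "K \<inter> S = K" using card_subset_eq[OF finite_K, of "K \<inter> S"] card_K by simp
  then show ?thesis by blast
qed

lemma card_fixed: "1 \<le> n \<Longrightarrow> card (fixed n) = p ^ n"
  unfolding fixed_def by (rule card_frobenius_fixed[OF prime_p char_p])

lemma finite_fixed: "1 \<le> n \<Longrightarrow> finite (fixed n)"
  using card_fixed[of n] prime_gt_0_nat[OF prime_p] card_gt_0_iff[of "fixed n"] by simp

lemma subfield_fixed: "subfield (fixed n) L"
proof (rule subfieldI')
  show "subring (fixed n) L"
  proof (rule subringI)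
    show "fixed n \<subseteq> carrier L" "\<one> \<in> fixed n" by (auto simp: fixed_def)
    fix x y assume xy: "x \<in> fixed n" "y \<in> fixed n"
    then show "x \<otimes> y \<in> fixed n" "x \<oplus> y \<in> fixed n"
      by (auto simp: fixed_def nat_pow_distrib frobenius_power_add[OF prime_p char_p])
    have "\<zero> [^] (p ^ n) = \<zero>" using prime_gt_0_nat[OF prime_p] by (simp add: nat_pow_zero)
    then show "\<ominus> x \<in> fixed n"
      using xy frobenius_power_diff[OF prime_p char_p, of \<zero> x n] by (auto simp: fixed_def a_minus_def)
  qed
  fix x assume x: "x \<in> fixed n - {\<zero>}"
  then have xu: "x \<in> Units L" "x \<in> carrier L" by (auto simp: fixed_def field_Units)
  have "(inv x) [^] (p ^ n) = inv (x [^] (p ^ n))"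
  proof (rule comm_inv_char[symmetric])
    show "x [^] (p ^ n) \<otimes> inv x [^] (p ^ n) = \<one>"
      using xu by (simp flip: nat_pow_distrib)
  qed (use xu in auto)
  then show "inv x \<in> fixed n" using x xu by (auto simp: fixed_def)
qed

lemma subring_fixed: "subring (fixed n) L"
  using subfieldE(1)[OF subfield_fixed] .

text \<open>
  In a field with \<open>p ^ n\<close> elements each element is a fixed point of the \<open>n\<close>-th power of Frobenius, and
  there are only \<open>p ^ n\<close> such points in \<open>L\<close>. Hence the uniqueness that the definite description in
  \<open>GF_in\<close> relies on.
\<close>

lemma subfield_card_eq_fixed:
  assumes F: "subfield F L" "card F = p ^ n" and n: "1 \<le> n"
  shows "F = fixed n"
proof (rule card_subset_eq[OF finite_fixed[OF n]])
  have "finite F" using F(2) prime_gt_0_nat[OF prime_p] card_gt_0_iff[of F] by simp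
  then show "F \<subseteq> fixed n"
    using pow_card_subfield[OF F(1)] F(2) subfieldE(3)[OF F(1)] by (auto simp: fixed_def)
  show "card F = card (fixed n)" using F(2) card_fixed[OF n] by simp
qed

lemma GF_in_eq_fixed: "1 \<le> n \<Longrightarrow> GF_in L p n = fixed n"
  unfolding GF_in_def
  by (rule the_equality) (use subfield_fixed card_fixed subfield_card_eq_fixed in auto)

lemma pow_add_exponent: "x \<in> carrier L \<Longrightarrow> x [^] (p ^ (m + k)) = (x [^] (p ^ m)) [^] (p ^ k)"
  by (simp add: nat_pow_pow power_add)

lemma fixed_mult:
  assumes "x \<in> fixed m"
  shows "x \<in> fixed (m * k)"
proof (induction k)
  case 0
  then show ?case using assms by (simp add: fixed_def nat_pow_eone del: One_nat_def)
next
  case (Suc k)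
  have "x [^] (p ^ (m + m * k)) = x"
    using assms Suc unfolding fixed_def by (simp add: pow_add_exponent)
  then show ?case using assms by (simp add: fixed_def)
qed

text \<open>
  The exponents \<open>n\<close> for which \<open>x\<close> is fixed are closed under sums and under differences, so the
  Euclidean algorithm applies.
\<close>

lemma fixed_gcd:
  assumes "x \<in> fixed m" "x \<in> fixed n"
  shows "x \<in> fixed (gcd m n)"
  using assms
proof (induction m n rule: gcd_nat_induct)
  case (step m n)
  let ?k = "n * (m div n)"
  have x: "x \<in> carrier L" "x [^] (p ^ ?k) = x"
    using fixed_mult[OF step.prems(2)] by (auto simp: fixed_def)
  have "x = x [^] (p ^ (?k + m mod n))" using step.prems(1) by (simp add: fixed_def)
  then have "x [^] (p ^ (m mod n)) = x" using pow_add_exponent[OF x(1), of ?k "m mod n"] x(2) by metis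
  then have "x \<in> fixed (m mod n)" using x(1) by (simp add: fixed_def)
  then show ?case using step by (simp add: gcd_red_nat[of m n])
qed simp

text \<open>
  If \<open>fixed m\<close> lies in \<open>fixed n\<close>, then it also lies in \<open>fixed (gcd m n)\<close>, and counting elements gives
  \<open>m \<le> gcd m n\<close>.
\<close>

lemma fixed_subset_iff_dvd:
  assumes "1 \<le> m" "1 \<le> n"
  shows "fixed m \<subseteq> fixed n \<longleftrightarrow> m dvd n"
proof
  assume "fixed m \<subseteq> fixed n"
  then have "fixed m \<subseteq> fixed (gcd m n)" using fixed_gcd by blast
  moreover have g: "1 \<le> gcd m n" using assms by (simp add: Suc_le_eq)
  ultimately have "p ^ m \<le> p ^ gcd m n"
    using card_mono[OF finite_fixed[OF g]] card_fixed assms(1) g by metis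
  then have "m \<le> gcd m n" using power_le_imp_le_exp[OF prime_gt_1_nat[OF prime_p]] by blast
  then have "m = gcd m n" using assms(1) by (simp add: gcd_le1_nat le_antisym)
  then show "m dvd n" by (metis gcd_dvd2)
next
  assume "m dvd n"
  then show "fixed m \<subseteq> fixed n" using fixed_mult by (auto elim!: dvdE)
qed

text \<open>
  Since \<open>x\<close> is algebraic over \<open>K\<close>, the ring \<open>K[x]\<close> is a field of finite dimension \<open>d\<close> over \<open>K\<close>. So
  it has \<open>p ^ d\<close> elements and equals \<open>fixed d\<close>, and it lies in \<open>S\<close> because \<open>S\<close> contains \<open>K\<close>.
\<close>

lemma element_in_fixed:
  assumes S: "subring S L" and x: "x \<in> S"
  obtains k where "1 \<le> k" "x \<in> fixed k" "fixed k \<subseteq> S"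
proof -
  have xL: "x \<in> carrier L" using subringE(1)[OF S] x by blast
  have alg: "(algebraic over K) x" by (rule algebraic_extension[OF xL])
  let ?F = "simple_extension K x"
  define d where "d = degree (Irr K x)"
  have F: "subfield ?F L"
    using simple_extension_is_subfield[OF subfield_axioms xL] alg by simp
  have cd: "card ?F = p ^ d"
    using card_dimension[OF subfield_axioms finite_K dimension_simple_extension[OF subfield_axioms xL alg]] card_K d_def by simp
  have "d \<noteq> 0"
  proof
    assume "d = 0"
    then obtain z where "?F = {z}" using cd by (auto simp: card_1_singleton_iff)
    then show False using subringE(2,3)[OF subfieldE(1)[OF F]] one_not_zero by auto
  qed
  then have "1 \<le> d" by simp
  moreover have "?F = fixed d" using subfield_card_eq_fixed[OF F cd \<open>1 \<le> d\<close>] .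
  moreover have "x \<in> ?F" using simple_extension_mem[OF subfieldE(1)[OF subfield_axioms] xL] .
  moreover have "?F \<subseteq> S" using simple_extension_subring_incl[OF S prime_field_subset[OF S] x] .
  ultimately show ?thesis using that by simp
qed

lemma subring_imp_subfield:
  assumes S: "subring S L"
  shows "subfield S L"
proof (rule subfieldI'[OF S])
  fix x assume x: "x \<in> S - {\<zero>}"
  then obtain k where "x \<in> fixed k" "fixed k \<subseteq> S" using element_in_fixed[OF S] by blast
  then show "inv x \<in> S" using subfield_m_inv(1)[OF subfield_fixed, of x k] x by blast
qed

lemma field_of_eq: "0 \<notin> T \<Longrightarrow> field_of L p T = (\<Union>n\<in>T. fixed n)"
  unfolding field_of_def by (rule SUP_cong) (auto intro!: GF_in_eq_fixed simp: Suc_le_eq intro: gr0I)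

lemma FG_eq: "FG L p S = {n. 1 \<le> n \<and> fixed n \<subseteq> S}"
  unfolding FG_def using GF_in_eq_fixed by auto

lemma field_of_FG:
  assumes "subring S L"
  shows "field_of L p (FG L p S) = S"
proof -
  have "0 \<notin> FG L p S" by (simp add: FG_eq)
  then show ?thesis
    using element_in_fixed[OF assms] by (subst field_of_eq) (auto simp: FG_eq, metis)
qed

text \<open>
  For least common multiples, the field \<open>S \<inter> fixed (lcm m n)\<close> is finite, hence of the form \<open>fixed k\<close>. It
  contains \<open>fixed m\<close> and \<open>fixed n\<close>, so \<open>k\<close> is a multiple of both \<open>m\<close> and \<open>n\<close>.
\<close>

lemma divisor_ideal_FG:
  assumes S: "subring S L"
  shows "divisor_ideal (FG L p S)"
proof -
  have "1 \<in> FG L p S"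
  proof -
    obtain k where k: "1 \<le> k" "fixed k \<subseteq> S" using element_in_fixed[OF S subringE(3)[OF S]] by blast
    then have "fixed 1 \<subseteq> fixed k" using fixed_subset_iff_dvd[of 1 k] by simp
    then show ?thesis using k by (simp add: FG_eq)
  qed
  moreover have "d \<in> FG L p S" if "n \<in> FG L p S" "d dvd n" for n d
  proof -
    have n: "1 \<le> n" "fixed n \<subseteq> S" using that(1) by (simp_all add: FG_eq)
    then have "1 \<le> d" using that(2) by (cases d) auto
    then show ?thesis using fixed_subset_iff_dvd[of d n] n that(2) by (auto simp: FG_eq)
  qed
  moreover have "lcm m n \<in> FG L p S" if "m \<in> FG L p S" "n \<in> FG L p S" for m n
  proof -
    have mn: "1 \<le> m" "fixed m \<subseteq> S" "1 \<le> n" "fixed n \<subseteq> S" using that by (simp_all add: FG_eq)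
    have l: "1 \<le> lcm m n" using mn by (simp add: Suc_le_eq lcm_pos_nat)
    let ?F = "S \<inter> fixed (lcm m n)"
    have F: "subring ?F L" using subring_inter[OF S subring_fixed] .
    have finF: "finite ?F" using finite_fixed[OF l] by simp
    obtain a where a: "a \<in> ?F" "\<And>H. subring H L \<Longrightarrow> a \<in> H \<Longrightarrow> ?F \<subseteq> H"
      using finite_subfield_generator[OF subring_imp_subfield[OF F] finF] by metis
    obtain k where k: "1 \<le> k" "a \<in> fixed k" "fixed k \<subseteq> ?F"
      using element_in_fixed[OF F a(1)] by blast
    have "?F \<subseteq> fixed k" using a(2)[OF subring_fixed k(2)] .
    moreover have "fixed m \<subseteq> ?F" "fixed n \<subseteq> ?F"
      using mn l fixed_subset_iff_dvd by auto
    ultimately have "fixed m \<subseteq> fixed k" "fixed n \<subseteq> fixed k" by blast+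
    then have "lcm m n dvd k" using fixed_subset_iff_dvd mn k(1) by (simp add: lcm_least)
    then have "fixed (lcm m n) \<subseteq> S" using k fixed_subset_iff_dvd[OF l k(1)] by blast
    then show ?thesis using l by (simp add: FG_eq)
  qed
  moreover have "0 \<notin> FG L p S" by (simp add: FG_eq)
  ultimately show ?thesis unfolding divisor_ideal_def by blast
qed

text \<open>
  Two elements from \<open>fixed m\<close> and \<open>fixed n\<close> both lie in \<open>fixed (lcm m n)\<close>: the union is directed.
\<close>

lemma subring_field_of:
  assumes T: "divisor_ideal T"
  shows "subring (field_of L p T) L"
proof -
  let ?F = "\<Union>n\<in>T. fixed n"
  have closed: "x \<otimes> y \<in> ?F \<and> x \<oplus> y \<in> ?F" if xy: "x \<in> ?F" "y \<in> ?F" for x y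
  proof -
    obtain m n where mn: "m \<in> T" "x \<in> fixed m" "n \<in> T" "y \<in> fixed n" using xy by blast
    have "1 \<le> m" "1 \<le> n" using mn(1,3) divisor_idealD(1)[OF T] by (metis not_less_eq_eq One_nat_def le_0_eq)+
    then have "1 \<le> lcm m n" by (simp add: Suc_le_eq lcm_pos_nat)
    then have "x \<in> fixed (lcm m n)" "y \<in> fixed (lcm m n)"
      using fixed_subset_iff_dvd \<open>1 \<le> m\<close> \<open>1 \<le> n\<close> mn by (meson dvd_lcm1 dvd_lcm2 subsetD)+
    then have "x \<otimes> y \<in> fixed (lcm m n)" "x \<oplus> y \<in> fixed (lcm m n)"
      using subringE(6,7)[OF subring_fixed] by blast+
    then show ?thesis using divisor_idealD(4)[OF T mn(1,3)] by blast
  qed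
  have "subring ?F L"
  proof (rule subringI)
    show "?F \<subseteq> carrier L" by (auto simp: fixed_def)
    show "\<one> \<in> ?F" using divisor_idealD(2)[OF T] subringE(3)[OF subring_fixed] by blast
    show "\<ominus> x \<in> ?F" if "x \<in> ?F" for x using that subringE(5)[OF subring_fixed] by blast
  qed (use closed in auto)
  then show ?thesis using field_of_eq divisor_idealD(1)[OF T] by simp
qed

text \<open>
  If \<open>fixed n\<close> is covered by the union over \<open>T\<close>, then a generator of it lies in a single \<open>fixed m\<close>, and
  \<open>n\<close> divides \<open>m\<close>.
\<close>

lemma FG_field_of:
  assumes T: "divisor_ideal T"
  shows "FG L p (field_of L p T) = T"
proof
  have eq: "field_of L p T = (\<Union>n\<in>T. fixed n)"
    using field_of_eq divisor_idealD(1)[OF T] by simp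
  have pos: "1 \<le> m" if "m \<in> T" for m
    using that divisor_idealD(1)[OF T] by (metis not_less_eq_eq One_nat_def le_0_eq)
  show "T \<subseteq> FG L p (field_of L p T)" using pos by (auto simp: FG_eq eq)
  show "FG L p (field_of L p T) \<subseteq> T"
  proof
    fix n assume "n \<in> FG L p (field_of L p T)"
    then have n: "1 \<le> n" "fixed n \<subseteq> (\<Union>n\<in>T. fixed n)" by (simp_all add: FG_eq eq)
    obtain a where a: "a \<in> fixed n" "\<And>H. subring H L \<Longrightarrow> a \<in> H \<Longrightarrow> fixed n \<subseteq> H"
      using finite_subfield_generator[OF subfield_fixed finite_fixed[OF n(1)]] by metis
    obtain m where m: "m \<in> T" "a \<in> fixed m" using a(1) n(2) by blast
    have "fixed n \<subseteq> fixed m" using a(2)[OF subring_fixed m(2)] .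
    then have "n dvd m" using fixed_subset_iff_dvd[OF n(1) pos[OF m(1)]] by simp
    then show "n \<in> T" using divisor_idealD(3)[OF T m(1)] by blast
  qed
qed

text \<open>
  The maximality clause in the definition of FG-sets says that \<open>T\<close> is the largest set of exponents
  that represents its field, that is \<open>T = FG(F\<^sub>p(T))\<close>.
\<close>

lemma FG_set_iff_divisor_ideal: "FG_set L p T \<longleftrightarrow> divisor_ideal T"
proof
  assume T: "FG_set L p T"
  let ?S = "field_of L p T"
  have S: "subring ?S L" and T1: "T \<subseteq> {1..}"
    and max: "\<And>T'. T \<subseteq> T' \<Longrightarrow> T' \<subseteq> {1..} \<Longrightarrow> field_of L p T' = ?S \<Longrightarrow> T = T'"
    using T subfieldE(1) unfolding FG_set_def by blast+
  have "T \<subseteq> FG L p ?S" using T1 unfolding FG_def field_of_def by auto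
  moreover have "FG L p ?S \<subseteq> {1..}" by (auto simp: FG_def)
  ultimately have "T = FG L p ?S" using max field_of_FG[OF S] by blast
  then show "divisor_ideal T" using divisor_ideal_FG[OF S] by simp
next
  assume T: "divisor_ideal T"
  have "T \<subseteq> {1..}" using FG_field_of[OF T] by (auto simp: FG_def)
  moreover have "subfield (field_of L p T) L" using subring_imp_subfield[OF subring_field_of[OF T]] .
  moreover have "T = T'" if T': "T \<subseteq> T'" "T' \<subseteq> {1..}" "field_of L p T' = field_of L p T" for T'
  proof -
    have "T' \<subseteq> FG L p (field_of L p T')" using T'(2) unfolding FG_def field_of_def by auto
    then show ?thesis using T'(1,3) FG_field_of[OF T] by simp
  qed
  ultimately show "FG_set L p T" unfolding FG_set_def by blast
qed

lemma maximal_FG_subset_iff: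
  "maximal_FG_subset L p T' T \<longleftrightarrow> divisor_ideal T \<and> maximal_subideal T' T"
  unfolding maximal_FG_subset_def maximal_subideal_def FG_set_iff_divisor_ideal by blast

lemma field_of_mono: "T \<subseteq> T' \<Longrightarrow> field_of L p T \<subseteq> field_of L p T'"
  unfolding field_of_def by blast

lemma FG_mono: "S \<subseteq> S' \<Longrightarrow> FG L p S \<subseteq> FG L p S'"
  unfolding FG_def by blast

lemma inj_on_field_of: "inj_on (field_of L p) {T. divisor_ideal T}"
  by (rule inj_on_inverseI[of _ "FG L p"]) (simp add: FG_field_of)

text \<open>
  \<open>FG\<close> and \<open>field_of\<close> are mutually inverse isomorphisms of partially ordered sets between the subrings
  of \<open>L\<close> and the divisor ideals, and such isomorphisms preserve the property of lying maximally below
  a given element.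
\<close>

lemma RgMax_eq_image:
  assumes E: "subring E L"
  shows "RgMax (L\<lparr>carrier := E\<rparr>) = field_of L p ` {T'. maximal_subideal T' (FG L p E)}"
proof -
  let ?T = "FG L p E"
  have max_iff: "maximal_subring S (L\<lparr>carrier := E\<rparr>) \<longleftrightarrow>
      subring S L \<and> S \<subset> E \<and> (\<forall>S'. subring S' L \<and> S \<subseteq> S' \<and> S' \<subset> E \<longrightarrow> S' = S)" for S
    unfolding maximal_subring_def subring_of_subring_iff[OF E] by auto
  have "\<exists>T'. maximal_subideal T' ?T \<and> S = field_of L p T'"
    if "maximal_subring S (L\<lparr>carrier := E\<rparr>)" for S
  proof -
    have S: "subring S L" "S \<subset> E"
      and maxS: "\<And>S'. subring S' L \<Longrightarrow> S \<subseteq> S' \<Longrightarrow> S' \<subset> E \<Longrightarrow> S' = S"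
      using that unfolding max_iff by blast+
    let ?U = "FG L p S"
    have "?U \<subset> ?T"
      using FG_mono[of S E] S(2) field_of_FG[OF S(1)] field_of_FG[OF E] by (metis psubset_eq)
    moreover have "V = ?U" if V: "divisor_ideal V" "?U \<subseteq> V" "V \<subset> ?T" for V
    proof -
      have "S \<subseteq> field_of L p V" using field_of_mono[OF V(2)] field_of_FG[OF S(1)] by simp
      moreover have "field_of L p V \<subset> E"
        using field_of_mono[of V ?T] V(3) field_of_FG[OF E] FG_field_of[OF V(1)] by (metis psubset_eq)
      ultimately have "field_of L p V = S" using maxS subring_field_of[OF V(1)] by blast
      then show ?thesis using FG_field_of[OF V(1)] by simp
    qed
    ultimately have "maximal_subideal ?U ?T"
      unfolding maximal_subideal_def using divisor_ideal_FG[OF S(1)] by blast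
    then show ?thesis using field_of_FG[OF S(1)] by metis
  qed
  moreover have "maximal_subring (field_of L p U) (L\<lparr>carrier := E\<rparr>)"
    if "maximal_subideal U ?T" for U
  proof -
    have U: "divisor_ideal U" "U \<subset> ?T"
      and maxU: "\<And>V. divisor_ideal V \<Longrightarrow> U \<subseteq> V \<Longrightarrow> V \<subset> ?T \<Longrightarrow> V = U"
      using that unfolding maximal_subideal_def by blast+
    have "field_of L p U \<subset> E"
      using field_of_mono[of U ?T] U field_of_FG[OF E] FG_field_of[OF U(1)] by (metis psubset_eq)
    moreover have "S' = field_of L p U"
      if S': "subring S' L" "field_of L p U \<subseteq> S'" "S' \<subset> E" for S'
    proof -
      have "U \<subseteq> FG L p S'" using FG_mono[OF S'(2)] FG_field_of[OF U(1)] by simp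
      moreover have "FG L p S' \<subset> ?T"
        using FG_mono[of S' E] S'(3) field_of_FG[OF S'(1)] field_of_FG[OF E] by (metis psubset_eq)
      ultimately have "FG L p S' = U" using maxU divisor_ideal_FG[OF S'(1)] by blast
      then show ?thesis using field_of_FG[OF S'(1)] by metis
    qed
    ultimately show ?thesis unfolding max_iff using subring_field_of[OF U(1)] by blast
  qed
  ultimately show ?thesis unfolding RgMax_def by blast
qed

end

section \<open>Maximal subrings of absolutely algebraic fields\<close>

theorem corollary1p9:
  fixes L :: "('a, 'b) ring_scheme" and K E :: "'a set" and p :: nat and T :: "nat set"
  assumes "Factorial_Ring.prime p"
    and "algebraic_closure L K" and "card K = p"
    and "subfield E L"
    and "T = FG L p E"
  shows "RgMax (L\<lparr>carrier := E\<rparr>) = {field_of L p T' | T'. maximal_FG_subset L p T' T}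
    \<and> (\<exists>\<phi>. bij_betw \<phi> (f_primes T) (RgMax (L\<lparr>carrier := E\<rparr>)))
    \<and> |RgMax (L\<lparr>carrier := E\<rparr>)| =o |f_primes T|
    \<and> (finite (RgMax (L\<lparr>carrier := E\<rparr>)) \<longleftrightarrow> finite (f_primes T))
    \<and> (finite (RgMax (L\<lparr>carrier := E\<rparr>)) \<longleftrightarrow>
        (\<exists>T0. FG_set L p T0 \<and> E = field_of L p T0 \<and> finite {T'. maximal_FG_subset L p T' T0}))"
proof -
  interpret prime_field_closure L K p
    using assms(1-3) by (simp add: prime_field_closure_def prime_field_closure_axioms_def)
  let ?R = "RgMax (L\<lparr>carrier := E\<rparr>)"
  have E: "subring E L" using subfieldE(1)[OF assms(4)] .
  have T: "divisor_ideal T" using divisor_ideal_FG[OF E] assms(5) by simp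
  have max: "maximal_FG_subset L p T' T \<longleftrightarrow> maximal_subideal T' T" for T'
    using T by (simp add: maximal_FG_subset_iff)
  have R: "?R = field_of L p ` {T'. maximal_subideal T' T}"
    using RgMax_eq_image[OF E] assms(5) by simp
  have inj: "inj_on (field_of L p) {T'. maximal_subideal T' T}"
    by (rule inj_on_subset[OF inj_on_field_of]) (auto simp: maximal_subideal_def)
  have bij: "bij_betw (field_of L p \<circ> (\<lambda>q. {n. q * n \<in> T})) (f_primes T) ?R"
    using bij_betw_trans[OF bij_betw_f_primes_maximal_subideals[OF T] inj_on_imp_bij_betw[OF inj]]
    unfolding R .
  have fin: "finite ?R \<longleftrightarrow> finite {T'. maximal_FG_subset L p T' T}"
    unfolding R max using finite_image_iff[OF inj] .
  have T0: "T0 = T" if "FG_set L p T0" "E = field_of L p T0" for T0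
    using FG_field_of[of T0] that assms(5) FG_set_iff_divisor_ideal by simp
  have FGT: "FG_set L p T" "E = field_of L p T"
    using T FG_set_iff_divisor_ideal field_of_FG[OF E] assms(5) by simp_all
  show ?thesis
  proof (intro conjI)
    show "?R = {field_of L p T' | T'. maximal_FG_subset L p T' T}"
      unfolding R max by blast
    show "\<exists>\<phi>. bij_betw \<phi> (f_primes T) ?R" using bij by blast
    show "|?R| =o |f_primes T|"
      using bij card_of_ordIso ordIso_symmetric by blast
    show "finite ?R \<longleftrightarrow> finite (f_primes T)" using bij_betw_finite[OF bij] by simp
    show "finite ?R \<longleftrightarrow> (\<exists>T0. FG_set L p T0 \<and> E = field_of L p T0 \<and> finite {T'. maximal_FG_subset L p T' T0})"
      using fin T0 FGT by metis
  qed
qed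

end
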